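(* Let $Q$ be a commutative A-loop of exponent $2$ (i.e. $x^2=1$ for all $x\in Q$). Define on $Q$ the operation $x\oplus y = \big( ((xy)\backslash x)\cdot((yx)\backslash y)\big)^{-1}$. Then $(Q,\oplus)$ is an elementary abelian $2$-group.
   Context: A loop is a set with a binary operation and neutral element $1$ in which all left and right translations $L_x:y\mapsto xy$, $R_x:y\mapsto yx$ are bijections; $\mathrm{Inn}(Q)$ is the stabilizer of $1$ in the group generated by all translations. A commutative A-loop is a commutative loop all of whose inner mappings are automorphisms. Left division: $x\backslash y$ is the unique $z$ with $xz=y$; $x^{-1}=x\backslash 1$. (In exponent $2$, $x\oplus y = x\backslash((xy)\backslash x)$.) *)

theory Defs
  imports "HOL-Algebra.Group"
begin

definition is_loop :: "'a set \<Rightarrow> ('a \<Rightarrow> 'a \<Rightarrow> 'a) \<Rightarrow> 'a \<Rightarrow> bool" where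
  "is_loop Q m e \<longleftrightarrow> e \<in> Q \<and> (\<forall>x\<in>Q. \<forall>y\<in>Q. m x y \<in> Q)
     \<and> (\<forall>x\<in>Q. m e x = x \<and> m x e = x)
     \<and> (\<forall>x\<in>Q. bij_betw (\<lambda>y. m x y) Q Q \<and> bij_betw (\<lambda>y. m y x) Q Q)"

text \<open>Translations, as permutations of the whole type that are the identity outside Q.\<close>
definition Ltr :: "'a set \<Rightarrow> ('a \<Rightarrow> 'a \<Rightarrow> 'a) \<Rightarrow> 'a \<Rightarrow> 'a \<Rightarrow> 'a" where
  "Ltr Q m x = (\<lambda>y. if y \<in> Q then m x y else y)"

definition Rtr :: "'a set \<Rightarrow> ('a \<Rightarrow> 'a \<Rightarrow> 'a) \<Rightarrow> 'a \<Rightarrow> 'a \<Rightarrow> 'a" where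
  "Rtr Q m x = (\<lambda>y. if y \<in> Q then m y x else y)"

inductive_set mlt :: "'a set \<Rightarrow> ('a \<Rightarrow> 'a \<Rightarrow> 'a) \<Rightarrow> ('a \<Rightarrow> 'a) set"
  for Q m where
  mlt_id: "id \<in> mlt Q m"
| mlt_L: "f \<in> mlt Q m \<Longrightarrow> x \<in> Q \<Longrightarrow> Ltr Q m x \<circ> f \<in> mlt Q m"
| mlt_R: "f \<in> mlt Q m \<Longrightarrow> x \<in> Q \<Longrightarrow> Rtr Q m x \<circ> f \<in> mlt Q m"
| mlt_Linv: "f \<in> mlt Q m \<Longrightarrow> x \<in> Q \<Longrightarrow> inv_into UNIV (Ltr Q m x) \<circ> f \<in> mlt Q m"
| mlt_Rinv: "f \<in> mlt Q m \<Longrightarrow> x \<in> Q \<Longrightarrow> inv_into UNIV (Rtr Q m x) \<circ> f \<in> mlt Q m"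

definition inn :: "'a set \<Rightarrow> ('a \<Rightarrow> 'a \<Rightarrow> 'a) \<Rightarrow> 'a \<Rightarrow> ('a \<Rightarrow> 'a) set" where
  "inn Q m e = {f \<in> mlt Q m. f e = e}"

definition is_loop_aut :: "'a set \<Rightarrow> ('a \<Rightarrow> 'a \<Rightarrow> 'a) \<Rightarrow> ('a \<Rightarrow> 'a) \<Rightarrow> bool" where
  "is_loop_aut Q m f \<longleftrightarrow> bij_betw f Q Q \<and> (\<forall>x\<in>Q. \<forall>y\<in>Q. f (m x y) = m (f x) (f y))"

definition comm_A_loop :: "'a set \<Rightarrow> ('a \<Rightarrow> 'a \<Rightarrow> 'a) \<Rightarrow> 'a \<Rightarrow> bool" where
  "comm_A_loop Q m e \<longleftrightarrow> is_loop Q m e \<and> (\<forall>x\<in>Q. \<forall>y\<in>Q. m x y = m y x)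
     \<and> (\<forall>f\<in>inn Q m e. is_loop_aut Q m f)"

definition ldiv :: "'a set \<Rightarrow> ('a \<Rightarrow> 'a \<Rightarrow> 'a) \<Rightarrow> 'a \<Rightarrow> 'a \<Rightarrow> 'a" where
  "ldiv Q m x y = (THE z. z \<in> Q \<and> m x z = y)"

definition linv :: "'a set \<Rightarrow> ('a \<Rightarrow> 'a \<Rightarrow> 'a) \<Rightarrow> 'a \<Rightarrow> 'a \<Rightarrow> 'a" where
  "linv Q m e x = ldiv Q m x e"

end

theory Submission
  imports Defs
begin

text \<open>
  Write \<open>L\<^sub>x\<close> for the translations, and let \<open>\<kappa>(x, y)\<close> be the commutator of \<open>L\<^sub>x\<close> and \<open>L\<^sub>y\<close>. It fixes the
  neutral element, hence is an automorphism, and exponent 2 makes it an involution.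
  The sum \<open>z = x \<oplus> y\<close> is characterised by \<open>[x, y, z] = 1\<close>, where the ternary operation
  \<open>[x, y, z] = x \ ((xy)(xz))\<close> is totally symmetric; moreover \<open>x \<oplus> y = \<kappa>(x, xy)(xy)\<close>.
  Put \<open>Y = xy\<close>, \<open>W = xw\<close> and \<open>t = [x, y, w]\<close>, so that \<open>xt = YW\<close>. Then
  \<open>(x \<oplus> y) \<oplus> w = \<kappa>(x, Y) \<kappa>(Y, t) t\<close>, and associativity amounts to the invariance of the right-hand
  side under exchanging \<open>Y\<close> and \<open>W\<close>. That invariance follows from the fact that \<open>\<kappa>(x, Y)\<close> and
  \<open>\<kappa>(x, W)\<close> commute at the point \<open>Y\<close>.
\<close>

locale comm_A_loop_exp2 =
  fixes Q :: "'a set" and mult :: "'a \<Rightarrow> 'a \<Rightarrow> 'a" (infixl "\<cdot>" 70) and e :: 'a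
  assumes comm_A_loop: "comm_A_loop Q mult e"
    and square [simp]: "x \<in> Q \<Longrightarrow> x \<cdot> x = e"
begin

abbreviation ldiv_op :: "'a \<Rightarrow> 'a \<Rightarrow> 'a" (infixl "\<setminus>" 70)
  where "x \<setminus> y \<equiv> ldiv Q mult x y"

section \<open>Loop arithmetic and left division\<close>

lemma is_loop: "is_loop Q mult e"
  using comm_A_loop by (simp add: comm_A_loop_def)

lemma e_closed [simp]: "e \<in> Q"
  and mult_closed [simp]: "x \<in> Q \<Longrightarrow> y \<in> Q \<Longrightarrow> x \<cdot> y \<in> Q"
  and e_mult [simp]: "x \<in> Q \<Longrightarrow> e \<cdot> x = x"
  and mult_e [simp]: "x \<in> Q \<Longrightarrow> x \<cdot> e = x"
  and bij_mult: "x \<in> Q \<Longrightarrow> bij_betw ((\<cdot>) x) Q Q"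
  using is_loop by (auto simp: is_loop_def)

lemma comm: "x \<in> Q \<Longrightarrow> y \<in> Q \<Longrightarrow> x \<cdot> y = y \<cdot> x"
  using comm_A_loop by (simp add: comm_A_loop_def)

lemma left_cancel: "x \<in> Q \<Longrightarrow> y \<in> Q \<Longrightarrow> z \<in> Q \<Longrightarrow> x \<cdot> y = x \<cdot> z \<longleftrightarrow> y = z"
  using bij_mult[of x] by (auto simp: bij_betw_def inj_on_def)

lemma ldiv_ex1:
  assumes "x \<in> Q" "y \<in> Q"
  shows "\<exists>!z. z \<in> Q \<and> x \<cdot> z = y"
proof -
  have "y \<in> (\<cdot>) x ` Q"
    using assms bij_mult by (simp add: bij_betw_def)
  then show ?thesis
    using assms by (auto simp: left_cancel)
qed

lemma ldiv_closed [simp]: "x \<in> Q \<Longrightarrow> y \<in> Q \<Longrightarrow> x \<setminus> y \<in> Q"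
  and mult_ldiv [simp]: "x \<in> Q \<Longrightarrow> y \<in> Q \<Longrightarrow> x \<cdot> (x \<setminus> y) = y"
  using theI'[OF ldiv_ex1[of x y]] by (simp_all add: ldiv_def)

lemma ldiv_mult [simp]: "x \<in> Q \<Longrightarrow> y \<in> Q \<Longrightarrow> x \<setminus> (x \<cdot> y) = y"
  using left_cancel[of x "x \<setminus> (x \<cdot> y)" y] by simp

lemma ldiv_mult' [simp]: "x \<in> Q \<Longrightarrow> y \<in> Q \<Longrightarrow> x \<setminus> (y \<cdot> x) = y"
  using comm ldiv_mult by metis

lemma ldiv_eqI: "x \<in> Q \<Longrightarrow> z \<in> Q \<Longrightarrow> x \<cdot> z = y \<Longrightarrow> x \<setminus> y = z"
  by auto

lemma e_ldiv [simp]: "x \<in> Q \<Longrightarrow> e \<setminus> x = x"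
  and ldiv_e [simp]: "x \<in> Q \<Longrightarrow> x \<setminus> e = x"
  and ldiv_self [simp]: "x \<in> Q \<Longrightarrow> x \<setminus> x = e"
  by (simp_all add: ldiv_eqI)

lemma ldiv_ldiv [simp]: "x \<in> Q \<Longrightarrow> y \<in> Q \<Longrightarrow> (x \<setminus> y) \<setminus> y = x"
  by (rule ldiv_eqI) (simp_all add: comm[of "x \<setminus> y" x])

section \<open>Translations and inner mappings\<close>

abbreviation L :: "'a \<Rightarrow> 'a \<Rightarrow> 'a"
  where "L \<equiv> Ltr Q mult"

abbreviation Linv :: "'a \<Rightarrow> 'a \<Rightarrow> 'a"
  where "Linv x \<equiv> inv_into UNIV (L x)"

lemma Ltr_apply [simp]: "v \<in> Q \<Longrightarrow> L x v = x \<cdot> v"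
  by (simp add: Ltr_def)

lemma inj_Ltr: "x \<in> Q \<Longrightarrow> inj (L x)"
  unfolding inj_def Ltr_def using left_cancel[of x] mult_closed[of x] by (auto split: if_splits)

lemma inv_Ltr_apply [simp]: "x \<in> Q \<Longrightarrow> v \<in> Q \<Longrightarrow> Linv x v = x \<setminus> v"
  by (rule inv_f_eq[OF inj_Ltr]) simp_all

text \<open>The automorphism axiom enters only here: each later use picks a word in translations
  that fixes \<open>e\<close>.\<close>

lemma inner_mult:
  assumes "f \<in> mlt Q mult" "f e = e" "u \<in> Q" "v \<in> Q"
  shows "f (u \<cdot> v) = f u \<cdot> f v"
  using comm_A_loop assms by (auto simp: comm_A_loop_def inn_def is_loop_aut_def)

lemmas mlt_rules = mlt_id mlt_L mlt_Linv


subsection \<open>The symmetric ternary operation\<close>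

text \<open>The inner mapping \<open>L\<^bsub>xy\<^esub>\<^sup>-\<^sup>1 L\<^sub>y L\<^sub>x\<^sup>-\<^sup>1\<close> fixes \<open>xy\<close>, hence commutes with \<open>L\<^bsub>xy\<^esub>\<close>.\<close>

lemma mult_swap_commute:
  assumes [simp]: "x \<in> Q" "y \<in> Q" "v \<in> Q"
  shows "(x \<cdot> y) \<cdot> (y \<cdot> (x \<setminus> v)) = y \<cdot> (x \<setminus> ((x \<cdot> y) \<cdot> v))"
proof -
  let ?c = "x \<cdot> y"
  let ?f = "Linv ?c \<circ> (L y \<circ> (Linv x \<circ> id))"
  have "?f \<in> mlt Q mult"
    by (intro mlt_rules) simp_all
  moreover have "?f e = e"
    by (simp add: comm[of y x])
  ultimately have "?f (?c \<cdot> v) = ?f ?c \<cdot> ?f v"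
    by (rule inner_mult) simp_all
  then have "?c \<setminus> (y \<cdot> (x \<setminus> (?c \<cdot> v))) = ?c \<cdot> (?c \<setminus> (y \<cdot> (x \<setminus> v)))"
    by simp
  then have "?c \<cdot> (?c \<setminus> (y \<cdot> (x \<setminus> (?c \<cdot> v)))) = ?c \<cdot> (y \<cdot> (x \<setminus> v))"
    by simp
  then show ?thesis
    by simp
qed

lemma ldiv_mult_ldiv:
  assumes [simp]: "x \<in> Q" "y \<in> Q" "v \<in> Q"
  shows "(x \<setminus> y) \<cdot> (x \<setminus> (y \<cdot> v)) = y \<cdot> ((x \<setminus> y) \<cdot> (x \<setminus> v))"
  using mult_swap_commute[of x "x \<setminus> y" v] by simp

text \<open>Put \<open>v = x \<cdot> z\<close> in \<open>mult_swap_commute\<close>. Symmetry in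
  \<open>y\<close> and \<open>z\<close> is plain commutativity, so the bracket is totally
  symmetric.\<close>

lemma bracket_sym:
  assumes [simp]: "x \<in> Q" "y \<in> Q" "z \<in> Q"
  shows "x \<setminus> ((x \<cdot> y) \<cdot> (x \<cdot> z)) = y \<setminus> ((x \<cdot> y) \<cdot> (y \<cdot> z))"
  using mult_swap_commute[of x y "x \<cdot> z"] by simp

text \<open>The inner mapping \<open>L\<^bsub>y\x\<^esub>\<^sup>-\<^sup>1 L\<^sub>y\<^sup>-\<^sup>1 L\<^sub>x\<close> maps \<open>x\y\<close> to \<open>y\x\<close>.\<close>

lemma ldiv_mult_mult:
  assumes [simp]: "x \<in> Q" "y \<in> Q" "v \<in> Q"
  shows "y \<setminus> (x \<cdot> ((x \<setminus> y) \<cdot> v)) = (y \<setminus> x) \<cdot> (y \<setminus> (x \<cdot> v))"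
proof -
  let ?d = "y \<setminus> x"
  let ?f = "Linv ?d \<circ> (Linv y \<circ> (L x \<circ> id))"
  have "?f \<in> mlt Q mult"
    by (intro mlt_rules) simp_all
  moreover have "?f e = e"
    by simp
  ultimately have "?f ((x \<setminus> y) \<cdot> v) = ?f (x \<setminus> y) \<cdot> ?f v"
    by (rule inner_mult) simp_all
  then have "?d \<setminus> (y \<setminus> (x \<cdot> ((x \<setminus> y) \<cdot> v))) = ?d \<cdot> (?d \<setminus> (y \<setminus> (x \<cdot> v)))"
    by simp
  then have "?d \<cdot> (?d \<setminus> (y \<setminus> (x \<cdot> ((x \<setminus> y) \<cdot> v)))) = ?d \<cdot> (y \<setminus> (x \<cdot> v))"
    by simp
  then show ?thesis
    by simp
qed

text \<open>With \<open>a = (xy)\x\<close> and \<open>b = (xy)\y\<close> one has \<open>[xy, a, b] = 1\<close>; now change the base point to \<open>a\<close>.\<close>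

lemma mult_ldiv_ldiv:
  assumes [simp]: "x \<in> Q" "y \<in> Q"
  shows "x \<cdot> (((x \<cdot> y) \<setminus> x) \<cdot> ((x \<cdot> y) \<setminus> y)) = (x \<cdot> y) \<setminus> x"
proof -
  let ?c = "x \<cdot> y"
  let ?a = "?c \<setminus> x" and ?b = "?c \<setminus> y"
  have "?a \<setminus> (x \<cdot> (?a \<cdot> ?b)) = e"
    using bracket_sym[of ?c ?a ?b] by simp
  then have "?a \<cdot> (?a \<setminus> (x \<cdot> (?a \<cdot> ?b))) = ?a"
    by simp
  then show ?thesis
    by simp
qed


subsection \<open>Commutators of translations\<close>

definition kap :: "'a \<Rightarrow> 'a \<Rightarrow> 'a \<Rightarrow> 'a"
  where "kap x y v = x \<setminus> (y \<setminus> (x \<cdot> (y \<cdot> v)))"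

lemma kap_closed [simp]: "x \<in> Q \<Longrightarrow> y \<in> Q \<Longrightarrow> v \<in> Q \<Longrightarrow> kap x y v \<in> Q"
  by (simp add: kap_def)

lemma kap_mult:
  assumes [simp]: "x \<in> Q" "y \<in> Q" "u \<in> Q" "v \<in> Q"
  shows "kap x y (u \<cdot> v) = kap x y u \<cdot> kap x y v"
proof -
  let ?f = "Linv x \<circ> (Linv y \<circ> (L x \<circ> (L y \<circ> id)))"
  have "?f \<in> mlt Q mult"
    by (intro mlt_rules) simp_all
  moreover have "?f e = e"
    by simp
  ultimately have "?f (u \<cdot> v) = ?f u \<cdot> ?f v"
    by (rule inner_mult) simp_all
  then show ?thesis
    by (simp add: kap_def)
qed

lemma kap_ldiv:
  assumes [simp]: "x \<in> Q" "y \<in> Q" "u \<in> Q" "v \<in> Q"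
  shows "kap x y (u \<setminus> v) = kap x y u \<setminus> kap x y v"
  using kap_mult[of x y u "u \<setminus> v"] by simp

lemma mult_mult_kap:
  assumes [simp]: "x \<in> Q" "y \<in> Q" "v \<in> Q"
  shows "y \<cdot> (x \<cdot> kap x y v) = x \<cdot> (y \<cdot> v)"
  by (simp add: kap_def)

lemma kap_right: "x \<in> Q \<Longrightarrow> y \<in> Q \<Longrightarrow> kap x y y = x \<setminus> (y \<setminus> x)"
  by (simp add: kap_def)

text \<open>
  For \<open>c = vu\<close>, \<open>a = c\u\<close>, \<open>b = c\v\<close> and \<open>z = ab\<close>, the automorphism \<open>k = \<kappa>(c, v)\<close> exchanges \<open>v\<close> with \<open>a\<close>,
  \<open>u\<close> with \<open>b\<close>, and \<open>c\<close> with \<open>z\<close>. Hence \<open>L\<^sub>z L\<^sub>b L\<^sub>c\<^sup>-\<^sup>1\<close> equals \<open>L\<^sub>b k\<close>, and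
  \<open>L\<^sub>z L\<^sub>b L\<^sub>c\<^sup>-\<^sup>1 k\<close> equals \<open>L\<^sub>b\<close>.
\<close>

lemma kap_kap [simp]:
  assumes [simp]: "c \<in> Q" "v \<in> Q" "w \<in> Q"
  shows "kap c v (kap c v w) = w"
proof -
  define u where "u = v \<setminus> c"
  define a b where "a = c \<setminus> u" and "b = c \<setminus> v"
  define z where "z = a \<cdot> b"
  define k where "k = kap c v"
  have [simp]: "u \<in> Q" "a \<in> Q" "b \<in> Q" "z \<in> Q"
    by (simp_all add: u_def a_def b_def z_def)
  have k_closed [simp]: "k p \<in> Q" if "p \<in> Q" for p
    using that by (simp add: k_def)
  have k_mult: "k (p \<cdot> q) = k p \<cdot> k q" and k_ldiv: "k (p \<setminus> q) = k p \<setminus> k q"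
    if "p \<in> Q" "q \<in> Q" for p q
    using that by (simp_all add: k_def kap_mult kap_ldiv)
  have vu: "v \<cdot> u = c"
    by (simp add: u_def)
  have vz: "v \<cdot> z = b"
    using mult_ldiv_ldiv[of v u] by (simp add: vu a_def b_def z_def comm)
  have uz: "u \<cdot> z = a"
    using mult_ldiv_ldiv[of u v] comm[of u v] by (simp add: vu a_def b_def z_def)
  have kv: "k v = a"
    by (simp add: k_def kap_right a_def u_def)
  have ku: "k u = b"
    by (simp add: k_def kap_def vu b_def)
  have kc: "k c = z"
    using k_mult[of v u] by (simp add: vu kv ku z_def)
  have "z \<setminus> b = v" "z \<setminus> a = u"
    using vz uz comm by (auto intro!: ldiv_eqI)
  then have ka: "k a = v" and kb: "k b = u"
    by (simp_all add: a_def[THEN arg_cong[of _ _ k]] b_def[THEN arg_cong[of _ _ k]] k_ldiv kc ku kv)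
  have kz: "k z = c"
    by (simp add: z_def[THEN arg_cong[of _ _ k]] k_mult ka kb vu)
  \<comment> \<open>As \<open>v \<cdot> u = c\<close>, the element \<open>c \<cdot> k p\<close> is
    the bracket of \<open>v\<close>, \<open>u\<close>, \<open>p\<close>; by symmetry
    \<open>u\<close> may replace \<open>v\<close>.\<close>
  have ck_v: "v \<cdot> (c \<cdot> k p) = c \<cdot> (v \<cdot> p)" if "p \<in> Q" for p
    using that by (simp add: k_def mult_mult_kap)
  have ck_u: "c \<cdot> k p = u \<setminus> (c \<cdot> (u \<cdot> p))" if [simp]: "p \<in> Q" for p
  proof -
    have "v \<setminus> (v \<cdot> (c \<cdot> k p)) = v \<setminus> (c \<cdot> (v \<cdot> p))"
      by (simp only: ck_v that)
    then show ?thesis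
      using bracket_sym[of v u p] by (simp add: vu)
  qed
  have 1: "z \<cdot> (b \<cdot> (c \<setminus> p)) = b \<cdot> k p" if [simp]: "p \<in> Q" for p
  proof -
    \<comment> \<open>Chosen to make \<open>ck_u\<close> yield
      \<open>k (u \<setminus> ?r) = c \<setminus> p\<close>.\<close>
    let ?r = "c \<setminus> (u \<cdot> p)"
    have "c \<cdot> k (u \<setminus> ?r) = p"
      using ck_u[of "u \<setminus> ?r"] by simp
    then have "k (u \<setminus> ?r) = c \<setminus> p"
      by (intro ldiv_eqI[symmetric]) simp_all
    then have "b \<cdot> (c \<setminus> p) = k ?r"
      by (metis \<open>b \<in> Q\<close> \<open>c \<in> Q\<close> \<open>u \<in> Q\<close> k_closed k_ldiv ku ldiv_closed mult_closed mult_ldiv that)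
    also have "\<dots> = z \<setminus> (b \<cdot> k p)"
      by (simp add: k_ldiv k_mult kc ku)
    finally show ?thesis
      by simp
  qed
  have 2: "z \<cdot> k p = a \<setminus> (z \<cdot> (a \<cdot> p))" if [simp]: "p \<in> Q" for p
  proof -
    \<comment> \<open>The value that the claim predicts for \<open>k p\<close>; \<open>k\<close>
      carries \<open>z\<close>, \<open>a\<close> to \<open>c\<close>, \<open>v\<close>, so
      \<open>ck_v\<close> confirms it.\<close>
    let ?r = "z \<setminus> (a \<setminus> (z \<cdot> (a \<cdot> p)))"
    have "c \<cdot> (v \<cdot> ?r) = v \<cdot> (c \<cdot> k ?r)"
      by (simp add: ck_v)
    also have "\<dots> = v \<cdot> k (a \<setminus> (z \<cdot> (a \<cdot> p)))"
      by (simp add: k_ldiv kz)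
    also have "\<dots> = c \<cdot> (v \<cdot> k p)"
      by (simp add: k_ldiv k_mult kz ka)
    finally have "?r = k p"
      by (simp add: left_cancel)
    then show ?thesis
      by (metis \<open>a \<in> Q\<close> \<open>z \<in> Q\<close> ldiv_closed mult_closed mult_ldiv that)
  qed
  \<comment> \<open>The factorisations \<open>z = a \<cdot> b\<close> and
    \<open>a = z \<cdot> u\<close> bring the left side into the form where 2, then 1, apply.\<close>
  have "b \<cdot> w = b \<cdot> (a \<setminus> (a \<cdot> w))"
    by simp
  also have "\<dots> = a \<setminus> (z \<cdot> (u \<cdot> (z \<setminus> (a \<cdot> w))))"
    using ldiv_mult_mult[of z a "z \<setminus> (a \<cdot> w)"] \<open>z \<setminus> a = u\<close> ldiv_eqI[of a b z] z_def by simp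
  also have "\<dots> = a \<setminus> (z \<cdot> (a \<cdot> (u \<cdot> (z \<setminus> w))))"
    using mult_swap_commute[of z u w] comm[of z u] uz by simp
  also have "\<dots> = z \<cdot> k (u \<cdot> (z \<setminus> w))"
    by (simp add: 2)
  also have "\<dots> = z \<cdot> (b \<cdot> (c \<setminus> k w))"
    by (simp add: k_mult k_ldiv ku kz)
  also have "\<dots> = b \<cdot> k (k w)"
    by (simp add: 1)
  finally show ?thesis
    by (simp add: left_cancel k_def)
qed

text \<open>Exchanging the translations inverts their commutator, which is an involution.\<close>

lemma kap_sym:
  assumes [simp]: "x \<in> Q" "y \<in> Q" "v \<in> Q"
  shows "kap x y v = kap y x v"
proof -
  have "kap y x (kap x y p) = p" if "p \<in> Q" for p
    using that by (simp add: kap_def)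
  from this[of "kap x y v"] show ?thesis
    by simp
qed

lemma kap_left: "x \<in> Q \<Longrightarrow> y \<in> Q \<Longrightarrow> kap x y x = y \<setminus> (x \<setminus> y)"
  using kap_sym[of x y x] kap_right[of y x] by simp

lemma mult_kap_right: "x \<in> Q \<Longrightarrow> y \<in> Q \<Longrightarrow> x \<cdot> kap x y y = y \<setminus> x"
  by (simp add: kap_right)

lemma mult_mult_kap':
  assumes [simp]: "x \<in> Q" "y \<in> Q" "v \<in> Q"
  shows "x \<cdot> (y \<cdot> kap x y v) = y \<cdot> (x \<cdot> v)"
  using mult_mult_kap[of y x v] kap_sym[of x y v] by simp

text \<open>Apply the involution to \<open>y \<setminus> x = x \<cdot> kap x y y\<close>.\<close>

lemma kap_swap_ldiv:
  assumes [simp]: "x \<in> Q" "y \<in> Q"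
  shows "kap x y (y \<setminus> x) = x \<setminus> y"
proof -
  have "kap x y (y \<setminus> x) = kap x y x \<cdot> kap x y (kap x y y)"
    using kap_mult[of x y x "kap x y y"] mult_kap_right[of x y] by simp
  also have "\<dots> = x \<setminus> y"
    by (simp add: kap_left comm[of _ y])
  finally show ?thesis .
qed

lemma kap_swap_ldiv':
  assumes [simp]: "x \<in> Q" "y \<in> Q"
  shows "kap x y (x \<setminus> y) = y \<setminus> x"
  using kap_swap_ldiv[of x y] kap_kap[of x y "y \<setminus> x"] by simp

lemma kap_ldiv_mult:
  assumes [simp]: "x \<in> Q" "y \<in> Q" "w \<in> Q"
  shows "kap x y (x \<setminus> (y \<cdot> w)) = (x \<setminus> w) \<cdot> kap x y y"
proof -
  have "x \<setminus> (y \<cdot> w) = y \<cdot> kap x y (x \<setminus> w)"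
    using mult_mult_kap'[of x y "x \<setminus> w"] by (intro ldiv_eqI) simp_all
  then show ?thesis
    by (simp add: kap_mult comm)
qed

lemma kap_ldiv_mult_ldiv:
  assumes [simp]: "x \<in> Q" "y \<in> Q" "v \<in> Q"
  shows "kap x y (y \<setminus> ((x \<setminus> y) \<cdot> v)) = (y \<setminus> x) \<cdot> (y \<setminus> v)"
proof -
  let ?r = "(x \<setminus> y) \<cdot> v"
  have "x \<cdot> kap x y (y \<setminus> ?r) = y \<setminus> (x \<cdot> ?r)"
    using mult_mult_kap[of x y "y \<setminus> ?r"] by (intro ldiv_eqI[symmetric]) simp_all
  also have "\<dots> = x \<cdot> ((y \<setminus> x) \<cdot> (y \<setminus> v))"
    by (simp add: ldiv_mult_mult ldiv_mult_ldiv)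
  finally show ?thesis
    by (simp add: left_cancel)
qed

subsection \<open>Commuting commutators\<close>

context
  fixes x Y W t :: 'a
  assumes in_Q [simp]: "x \<in> Q" "Y \<in> Q" "W \<in> Q" "t \<in> Q"
    and xt: "x \<cdot> t = Y \<cdot> W"
begin

lemma ldiv_mult_kap: "(x \<setminus> W) \<cdot> kap x Y Y = kap x Y t"
  using kap_ldiv_mult[of x Y W] by (simp add: xt[symmetric])

lemma kap_ldiv_t: "kap x Y (Y \<setminus> t) = x \<setminus> W"
  by (simp add: kap_ldiv ldiv_mult_kap[symmetric])

lemma ldiv_mult_mult_kap: "x \<setminus> (W \<cdot> (x \<cdot> v)) = W \<cdot> kap x W v" if [simp]: "v \<in> Q" for v
  using mult_mult_kap'[of x W v] by (intro ldiv_eqI) simp_all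

text \<open>With \<open>k = kap x Y\<close> and \<open>l = kap x W\<close>, the element
  \<open>l (k t)\<close> is \<open>l (k Y)\<close> times \<open>W \<setminus> x\<close>. So
  \<open>mult_swap_commute\<close> applies to \<open>W\<close> and \<open>l (k Y)\<close>; the
  result is pulled back along \<open>k\<close> after \<open>l\<close>.\<close>

lemma kap_kap_mult_t:
  "(Y \<cdot> kap x Y (kap x W W)) \<cdot> t = Y \<cdot> kap x Y (kap x W (Y \<setminus> x))"
proof -
  define k l where "k = kap x Y" and "l = kap x W"
  note kl = k_def[symmetric] l_def[symmetric]
  have [simp]: "k p \<in> Q" "l p \<in> Q" "k (k p) = p" "l (l p) = p" if "p \<in> Q" for p
    using that by (simp_all add: k_def l_def)
  have hom: "k (p \<cdot> q) = k p \<cdot> k q" "l (p \<cdot> q) = l p \<cdot> l q" if "p \<in> Q" "q \<in> Q" for p q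
    using that by (simp_all add: k_def l_def kap_mult)
  have "l (k t) = (W \<setminus> x) \<cdot> l (k Y)"
    using ldiv_mult_kap[symmetric] kap_swap_ldiv'[of x W] by (simp add: kl hom)
  moreover have "x \<cdot> (W \<cdot> l (k Y)) = W \<cdot> (Y \<setminus> x)"
    using mult_mult_kap'[of x W "k Y"] mult_kap_right[of x Y] by (simp add: kl)
  ultimately have "(W \<cdot> l (k Y)) \<cdot> l (k t) = l (k Y) \<cdot> (Y \<setminus> x)"
    using mult_swap_commute[of W "l (k Y)" x] by (simp add: comm)
  then have "k (l ((W \<cdot> l (k Y)) \<cdot> l (k t))) = k (l (l (k Y) \<cdot> (Y \<setminus> x)))"
    by (rule arg_cong)
  then show ?thesis
    by (simp add: hom kl comm)
qed

text \<open>The right-hand side is symmetric in \<open>Y\<close> and \<open>W\<close>, which will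
  make the two commutators commute at \<open>t\<close>.\<close>

lemma mult_kap_kap_t: "x \<cdot> kap x W (kap x Y t) = (W \<setminus> x) \<cdot> (Y \<setminus> x)"
proof -
  define k l where "k = kap x Y" and "l = kap x W"
  note kl = k_def[symmetric] l_def[symmetric]
  have [simp]: "k p \<in> Q" "l p \<in> Q" "k (k p) = p" "l (l p) = p" if "p \<in> Q" for p
    using that by (simp_all add: k_def l_def)
  have hom: "k (p \<cdot> q) = k p \<cdot> k q" "l (p \<cdot> q) = l p \<cdot> l q" if "p \<in> Q" "q \<in> Q" for p q
    using that by (simp_all add: k_def l_def kap_mult)
  have k1: "k (Y \<setminus> t) = x \<setminus> W" and l1: "l (x \<setminus> W) = W \<setminus> x" and l2: "l (W \<setminus> x) = x \<setminus> W"
    using kap_ldiv_t kap_swap_ldiv'[of x W] kap_swap_ldiv[of x W] by (simp_all add: kl)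
  have "l x = (x \<setminus> W) \<cdot> l W"
    using hom(2)[of W "W \<setminus> x"] by (simp add: l2 comm)
  then have klx: "k (l x) = (Y \<setminus> t) \<cdot> k (l W)"
    by (simp add: hom k1[symmetric])
  have "Y \<setminus> (t \<cdot> (Y \<cdot> k (l W))) = k (l (Y \<setminus> x))"
    using kap_kap_mult_t by (intro ldiv_eqI) (simp_all add: kl comm)
  then have "(Y \<setminus> t) \<cdot> k (l (Y \<setminus> x)) = t \<cdot> k (l x)"
    using ldiv_mult_ldiv[of Y t "Y \<cdot> k (l W)"] by (simp add: klx)
  then have "l (k ((Y \<setminus> t) \<cdot> k (l (Y \<setminus> x)))) = l (k (t \<cdot> k (l x)))"
    by (rule arg_cong)
  then show ?thesis
    by (simp add: hom k1 l1 kl comm)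
qed

text \<open>Use \<open>mult_swap_commute\<close> for the product
  \<open>x \<cdot> kap x Y Y = Y \<setminus> x\<close>, then apply \<open>kap x Y\<close>.\<close>

lemma kap_mult_kap_kap: "kap x Y (W \<cdot> kap x W (kap x Y Y)) = Y \<setminus> ((x \<setminus> Y) \<cdot> t)"
proof -
  have "(Y \<setminus> x) \<cdot> kap x Y t = kap x Y Y \<cdot> (W \<cdot> kap x W (kap x Y Y))"
    using mult_swap_commute[of x "kap x Y Y" W] ldiv_mult_mult_kap[of "kap x Y Y"] ldiv_mult_kap
    by (simp add: mult_kap_right comm)
  then have "kap x Y ((Y \<setminus> x) \<cdot> kap x Y t) = kap x Y (kap x Y Y \<cdot> (W \<cdot> kap x W (kap x Y Y)))"
    by (rule arg_cong)
  then have "(x \<setminus> Y) \<cdot> t = Y \<cdot> kap x Y (W \<cdot> kap x W (kap x Y Y))"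
    by (simp add: kap_mult kap_swap_ldiv)
  then show ?thesis
    by simp
qed

end

text \<open>Commuting at \<open>t\<close> writes \<open>t\<close> as
  \<open>l (k (W \<setminus> x))\<close> times \<open>l (k (l (k Y)))\<close>. The first factor
  turns out to be \<open>Y \<setminus> t\<close>, so the second must be \<open>Y\<close>.\<close>

lemma kap_commute:
  assumes [simp]: "x \<in> Q" "Y \<in> Q" "W \<in> Q"
  shows "kap x W (kap x Y Y) = kap x Y (kap x W Y)"
proof -
  define t where "t = x \<setminus> (Y \<cdot> W)"
  have t [simp]: "t \<in> Q" and xt: "x \<cdot> t = Y \<cdot> W" and xt': "x \<cdot> t = W \<cdot> Y"
    by (simp_all add: t_def comm[of W Y])
  define k l where "k = kap x Y" and "l = kap x W"
  note kl = k_def[symmetric] l_def[symmetric]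
  have [simp]: "k p \<in> Q" "l p \<in> Q" "k (k p) = p" "l (l p) = p" if "p \<in> Q" for p
    using that by (simp_all add: k_def l_def)
  have hom: "k (p \<cdot> q) = k p \<cdot> k q" "l (p \<cdot> q) = l p \<cdot> l q" if "p \<in> Q" "q \<in> Q" for p q
    using that by (simp_all add: k_def l_def kap_mult)
  have "x \<cdot> l (k t) = x \<cdot> k (l t)"
    using mult_kap_kap_t[OF assms t xt] mult_kap_kap_t[OF assms(1,3,2) t xt'] by (simp add: kl comm)
  then have "k (l t) = l (k t)"
    by (simp add: left_cancel)
  also have "\<dots> = (W \<setminus> x) \<cdot> l (k Y)"
    using ldiv_mult_kap[OF assms t xt, symmetric] kap_swap_ldiv'[of x W] by (simp add: kl hom)
  finally have "l (k (k (l t))) = l (k ((W \<setminus> x) \<cdot> l (k Y)))"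
    by (rule arg_cong)
  then have t_eq: "t = l (k (W \<setminus> x)) \<cdot> l (k (l (k Y)))"
    by (simp add: hom)
  \<comment> \<open>Second evaluation: \<open>t \<cdot> (W \<cdot> l (k Y))\<close> is computed in
    two ways to identify \<open>l (k (W \<setminus> x))\<close>.\<close>
  have "W \<cdot> l (k Y) = k (Y \<setminus> ((x \<setminus> Y) \<cdot> t))"
    using kap_mult_kap_kap[OF assms t xt, symmetric] by (simp add: kl)
  also have "\<dots> = (Y \<setminus> x) \<cdot> (Y \<setminus> t)"
    by (simp add: k_def kap_ldiv_mult_ldiv)
  finally have "t \<cdot> (W \<cdot> l (k Y)) = (Y \<setminus> t) \<cdot> (Y \<setminus> (t \<cdot> x))"
    using mult_swap_commute[of Y "Y \<setminus> t" x] by (simp add: comm)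
  also have "t \<cdot> x = Y \<cdot> W"
    by (simp add: xt comm[of _ x])
  finally have "W \<cdot> l (k (W \<setminus> x)) = W \<cdot> (Y \<setminus> t)"
    using kap_kap_mult_t[OF assms(1,3,2) t xt'] by (simp add: kl comm)
  then have "l (k (W \<setminus> x)) = Y \<setminus> t"
    by (simp add: left_cancel)
  from t_eq[unfolded this] have "(Y \<setminus> t) \<cdot> l (k (l (k Y))) = (Y \<setminus> t) \<cdot> Y"
    by (simp add: comm[of _ Y])
  then have "l (k (l (k Y))) = Y"
    by (simp add: left_cancel)
  then have "k (l (l (k (l (k Y))))) = k (l Y)"
    by simp
  then show ?thesis
    by (simp add: kl)
qed

lemma kap_kap_exchange:
  assumes [simp]: "x \<in> Q" "Y \<in> Q" "W \<in> Q" "t \<in> Q" and xt: "x \<cdot> t = Y \<cdot> W"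
  shows "kap Y t (kap Y x x) = kap W t (kap W x x)"
proof -
  have *: "t \<cdot> kap V t (kap V x x) = kap x V U \<cdot> kap x U V"
    if [simp]: "V \<in> Q" "U \<in> Q" and xt': "x \<cdot> t = V \<cdot> U" for U V
  proof -
    have "t \<cdot> kap V t (kap V x x) = V \<setminus> (t \<cdot> (V \<cdot> kap V x x))"
      using mult_mult_kap'[of V t "kap V x x"] by (intro ldiv_eqI[symmetric]) simp_all
    also have "\<dots> = V \<setminus> ((x \<setminus> V) \<cdot> t)"
      by (simp add: mult_kap_right comm)
    \<comment> \<open>\<open>kap_commute\<close> moves \<open>kap x V\<close> outermost, where it
      cancels and leaves a product symmetric in \<open>U\<close> and \<open>V\<close>.\<close>
    also have "\<dots> = kap x V U \<cdot> kap x V (kap x V (kap x U V))"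
      using kap_mult_kap_kap[OF _ _ _ _ xt'] kap_commute[of x V U] by (simp add: kap_mult)
    finally show ?thesis
      by simp
  qed
  have "t \<cdot> kap Y t (kap Y x x) = t \<cdot> kap W t (kap W x x)"
    using *[of Y W] *[of W Y] xt by (simp add: comm)
  then show ?thesis
    by (simp add: left_cancel)
qed


subsection \<open>The elementary abelian group\<close>

text \<open>A form with a single outer division, close to \<open>kap\<close>;
  \<open>oplus_eq\<close> ties it to the operation of the theorem.\<close>

definition oplus :: "'a \<Rightarrow> 'a \<Rightarrow> 'a" (infixl "\<oplus>\<oplus>" 65)
  where "x \<oplus>\<oplus> y = x \<setminus> ((x \<cdot> y) \<setminus> x)"

lemma oplus_closed [simp]: "x \<in> Q \<Longrightarrow> y \<in> Q \<Longrightarrow> x \<oplus>\<oplus> y \<in> Q"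
  by (simp add: oplus_def)

text \<open>Exponent 2 makes inversion trivial, and \<open>mult_ldiv_ldiv\<close> identifies the
  remaining product.\<close>

lemma oplus_eq:
  assumes [simp]: "x \<in> Q" "y \<in> Q"
  shows "linv Q mult e (((x \<cdot> y) \<setminus> x) \<cdot> ((y \<cdot> x) \<setminus> y)) = x \<oplus>\<oplus> y"
proof -
  have "x \<oplus>\<oplus> y = ((x \<cdot> y) \<setminus> x) \<cdot> ((x \<cdot> y) \<setminus> y)"
    unfolding oplus_def by (rule ldiv_eqI) (simp_all add: mult_ldiv_ldiv)
  then show ?thesis
    by (simp add: linv_def comm[of y x])
qed

lemma oplus_comm:
  assumes [simp]: "x \<in> Q" "y \<in> Q"
  shows "x \<oplus>\<oplus> y = y \<oplus>\<oplus> x"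
  using oplus_eq[of x y] oplus_eq[of y x] comm by simp

text \<open>Given commutativity, exchanging the last two summands amounts to associativity.\<close>

lemma oplus_oplus:
  assumes [simp]: "x \<in> Q" "y \<in> Q" "w \<in> Q"
  shows "(x \<oplus>\<oplus> y) \<oplus>\<oplus> w = (x \<oplus>\<oplus> w) \<oplus>\<oplus> y"
proof -
  define Y W t where "Y = x \<cdot> y" and "W = x \<cdot> w" and "t = x \<setminus> (Y \<cdot> W)"
  have [simp]: "Y \<in> Q" "W \<in> Q" "t \<in> Q" and xt: "x \<cdot> t = Y \<cdot> W"
    by (simp_all add: Y_def W_def t_def)
  have *: "(x \<oplus>\<oplus> y) \<oplus>\<oplus> w = kap V x (kap V t t)"
    if [simp]: "y \<in> Q" "w \<in> Q" and V: "V = x \<cdot> y" and xt: "x \<cdot> t = V \<cdot> (x \<cdot> w)" for y w V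
  proof -
    let ?k = "kap x V" and ?u = "V \<setminus> t"
    have [simp]: "V \<in> Q"
      by (simp add: V)
    have w: "w = ?k ?u"
      using kap_ldiv_t[OF _ _ _ _ xt] by simp
    have "(x \<oplus>\<oplus> y) \<oplus>\<oplus> w = w \<oplus>\<oplus> ?k V"
      by (simp add: oplus_comm oplus_def[of x y] V kap_right)
    also have "\<dots> = w \<setminus> (?k t \<setminus> w)"
      using ldiv_mult_kap[OF _ _ _ _ xt] by (simp add: oplus_def)
    also have "\<dots> = ?k (?u \<setminus> (t \<setminus> ?u))"
      by (simp add: w kap_ldiv)
    \<comment> \<open>Since \<open>V \<cdot> ?u = t\<close>, the two sides are the sums of
      \<open>?u\<close> and \<open>V\<close> in either order.\<close>
    also have "?u \<setminus> (t \<setminus> ?u) = V \<setminus> (t \<setminus> V)"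
      using oplus_comm[of V ?u] by (simp add: oplus_def comm[of ?u V])
    finally show ?thesis
      by (simp add: kap_right kap_sym[of x V])
  qed
  have "(x \<oplus>\<oplus> y) \<oplus>\<oplus> w = kap Y x (kap Y t t)"
    by (rule *) (simp_all add: xt Y_def W_def)
  also have "\<dots> = kap W x (kap W t t)"
    \<comment> \<open>here \<open>x\<close> and \<open>t\<close> exchange their roles\<close>
    by (rule kap_kap_exchange) (simp_all add: xt comm[of t x])
  also have "\<dots> = (x \<oplus>\<oplus> w) \<oplus>\<oplus> y"
    by (rule *[symmetric]) (simp_all add: xt Y_def W_def comm)
  finally show ?thesis .
qed

lemma oplus_assoc:
  assumes "x \<in> Q" "y \<in> Q" "z \<in> Q"
  shows "(x \<oplus>\<oplus> y) \<oplus>\<oplus> z = x \<oplus>\<oplus> (y \<oplus>\<oplus> z)"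
  using assms oplus_oplus[of y x z] oplus_comm[of x y] oplus_comm[of x "y \<oplus>\<oplus> z"] by simp

end

theorem theorem6p2:
  fixes Q :: "'a set" and m :: "'a \<Rightarrow> 'a \<Rightarrow> 'a" and e :: 'a
  assumes "comm_A_loop Q m e"
    and "\<forall>x\<in>Q. m x x = e"
  shows "\<exists>u. comm_group \<lparr>carrier = Q,
              mult = (\<lambda>x y. linv Q m e (m (ldiv Q m (m x y) x) (ldiv Q m (m y x) y))),
              one = u\<rparr>
          \<and> (\<forall>x\<in>Q. linv Q m e (m (ldiv Q m (m x x) x) (ldiv Q m (m x x) x)) = u)"
proof -
  interpret comm_A_loop_exp2 Q m e
    using assms by unfold_locales auto
  let ?G = "\<lparr>carrier = Q,
              mult = (\<lambda>x y. linv Q m e (m (ldiv Q m (m x y) x) (ldiv Q m (m y x) y))),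
              one = e\<rparr>"
  have "comm_group ?G"
  proof (rule comm_groupI)
    fix x y assume "x \<in> carrier ?G" "y \<in> carrier ?G"
    then show "x \<otimes>\<^bsub>?G\<^esub> y = y \<otimes>\<^bsub>?G\<^esub> x"
      by (simp add: oplus_eq oplus_comm)
  next
    fix x assume "x \<in> carrier ?G"
    then show "\<exists>y\<in>carrier ?G. y \<otimes>\<^bsub>?G\<^esub> x = \<one>\<^bsub>?G\<^esub>"
      by (intro bexI[of _ x]) (simp_all add: linv_def)
  qed (simp_all add: oplus_eq oplus_assoc, simp add: linv_def)
  moreover have "\<forall>x\<in>Q. linv Q m e (m (ldiv Q m (m x x) x) (ldiv Q m (m x x) x)) = e"
    by (simp add: linv_def)
  ultimately show ?thesis
    by blast
qed

end
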